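(* Let $L>0$, let $\bar x\in\operatorname{int}(\operatorname{dom}\psi)$, and let $z_1,\dots,z_m\in\operatorname{dom}\psi$. Assume that $d$ is strongly convex with parameter one with respect to $\|\cdot\|$. Let $\{\lambda_k\}_{k\ge0}\subset\Delta_m$ be generated by the Frank-Wolfe method applied to $\min_{\lambda\in\Delta_m}\xi_L(\lambda)$: $\lambda_0=\frac1m(1,\dots,1)^T$ and, for $k\ge0$, $$i_k\in\arg\min_{1\le i\le m}\nabla_i\xi_L(\lambda_k),\qquad \lambda_{k+1}=\frac{k}{k+2}\lambda_k+\frac{2}{k+2}e_{i_k},$$ where $e_i$ is the $i$th coordinate vector of $\mathbb{R}^m$. Put $\delta_L(\bar\lambda)=\max_{\lambda\in\Delta_m}\langle\nabla\xi_L(\bar\lambda),\bar\lambda-\lambda\rangle$ and $\delta_L^*(T)=\min_{0\le k\le T}\delta_L(\lambda_k)$. Then for all integers $T\ge1$, $$\delta_L^*(T)\le\frac{18}{L\cdot T}\max_{1\le i\le m}\|g_i\|_*^2.$$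
   Context: $\mathbb{E}$ is a finite-dimensional real vector space with dual $\mathbb{E}^*$; $\langle s,x\rangle$ is the value of $s\in\mathbb{E}^*$ at $x\in\mathbb{E}$ (the same notation is used for the standard inner product on $\mathbb{R}^m$). $\|\cdot\|$ is an arbitrary norm on $\mathbb{E}$ and $\|s\|_*=\sup\{\langle s,h\rangle:\|h\|\le1\}$ is the dual norm on $\mathbb{E}^*$. The prox-function $d$ is a closed convex function on $\mathbb{E}$, differentiable on $\operatorname{int}(\operatorname{dom} d)$; strong convexity with parameter one means $$d(y)\ge d(x)+\langle\nabla d(x),y-x\rangle+\tfrac12\|y-x\|^2,\quad x\in\operatorname{int}(\operatorname{dom} d),\ y\in\operatorname{dom} d.$$ $f$ is a differentiable closed convex function with open domain $\operatorname{dom} f\subseteq\operatorname{dom} d$, and $\psi:\mathbb{E}\to\mathbb{R}\cup\{+\infty\}$ is a proper closed convex function with $\operatorname{dom}\psi\subseteq\operatorname{dom} f$ and $\operatorname{int}(\operatorname{dom}\psi)\ne\emptyset$. For $L>0$ and $s\in\mathbb{E}^*$, $$\Phi_L(s)=\max_{y\in\operatorname{dom}\psi}\{\langle s,y\rangle-Ld(y)-\psi(y)\},$$ with unique maximizer $y^*_L(s)$ (under the strong convexity of $d$ the maximum is attained for every $s$); $\Phi_L$ is differentiable with $\nabla\Phi_L(s)=y_L^*(s)$. Put $f_i=f(z_i)$, $g_i=\nabla f(z_i)$, $G\lambda=\sum_{i=1}^m\lambda^{(i)}g_i$ for $\lambda\in\mathbb{R}^m$, $f_*\in\mathbb{R}^m$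 with $f_*^{(i)}=\langle g_i,z_i\rangle-f_i$. $\Delta_m$ is the standard simplex in $\mathbb{R}^m$, and $$\xi_L(\lambda)=\Phi_L(L\nabla d(\bar x)-G\lambda)+\langle\lambda,f_*\rangle+\alpha,\qquad\alpha=L[d(\bar x)-\langle\nabla d(\bar x),\bar x\rangle].$$ *)

theory Defs
  imports "HOL-Analysis.Analysis"
begin

text \<open>
  The space \<open>E\<close> is a type of class \<^class>\<open>real_normed_vector\<close> that satisfies
  \<open>finite_dimensional\<close>; its class norm plays the role of the arbitrary norm.
  In finite dimension every linear functional is bounded, so \<open>'a \<Rightarrow>\<^sub>L real\<close> is the
  whole dual space.
\<close>

definition finite_dimensional :: "'a::real_vector itself \<Rightarrow> bool" where
  "finite_dimensional _ \<longleftrightarrow> (\<exists>B::'a set. finite B \<and> span B = UNIV)"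

definition dual_norm :: "('a::real_normed_vector \<Rightarrow>\<^sub>L real) \<Rightarrow> real" where
  "dual_norm s = (SUP h\<in>{h. norm h \<le> 1}. blinfun_apply s h)"

text \<open>The set in \<open>dual_norm\<close> is bounded above, and \<open>dual_norm\<close> is the library norm.\<close>

lemma dual_norm_eq_norm: "dual_norm s = norm s"
proof (rule antisym)
  have le: "blinfun_apply s h \<le> norm s" if "norm h \<le> 1" for h
  proof -
    have "blinfun_apply s h \<le> norm s * norm h"
      using norm_blinfun[of s h] by simp
    also have "\<dots> \<le> norm s * 1"
      using that by (intro mult_left_mono) auto
    finally show ?thesis by simp
  qed
  have bdd: "bdd_above (blinfun_apply s ` {h. norm h \<le> 1})"
    using le by (intro bdd_aboveI2[where M = "norm s"]) auto
  have "(0::'a) \<in> {h. norm h \<le> 1}" by simp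
  then have ne: "{h::'a. norm h \<le> 1} \<noteq> {}" by blast
  show "dual_norm s \<le> norm s"
    unfolding dual_norm_def using le by (intro cSUP_least[OF ne]) auto
  have up: "blinfun_apply s h \<le> dual_norm s" if "norm h \<le> 1" for h
    unfolding dual_norm_def using that by (intro cSUP_upper bdd) auto
  show "norm s \<le> dual_norm s"
  proof (rule norm_blinfun_bound)
    show "0 \<le> dual_norm s" using up[of 0] by (simp add: blinfun.zero_right)
  next
    fix x :: 'a
    show "norm (blinfun_apply s x) \<le> dual_norm s * norm x"
    proof (cases "x = 0")
      case False
      have "blinfun_apply s (x /\<^sub>R norm x) \<le> dual_norm s"
           "blinfun_apply s (- (x /\<^sub>R norm x)) \<le> dual_norm s"
        using False by (auto intro!: up)
      with False show ?thesis
        by (simp add: blinfun.scaleR_right blinfun.minus_right field_simps abs_le_iff)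
    qed (simp add: blinfun.zero_right)
  qed
qed

text \<open>
  Convex functions take values in the reals extended by \<open>+\<infinity>\<close>; on the effective
  domain they are read as real functions through \<^const>\<open>real_of_ereal\<close>.
\<close>

definition edom :: "('a \<Rightarrow> ereal) \<Rightarrow> 'a set" where
  "edom f = {x. f x < \<infinity>}"

definition epigraph :: "('a \<Rightarrow> ereal) \<Rightarrow> ('a \<times> real) set" where
  "epigraph f = {(x, t). f x \<le> ereal t}"

definition closed_convex :: "('a::real_normed_vector \<Rightarrow> ereal) \<Rightarrow> bool" where
  "closed_convex f \<longleftrightarrow> (\<forall>x. f x \<noteq> -\<infinity>) \<and> convex (epigraph f) \<and> closed (epigraph f)"

definition proper :: "('a \<Rightarrow> ereal) \<Rightarrow> bool" where
  "proper f \<longleftrightarrow> (\<forall>x. f x \<noteq> -\<infinity>) \<and> edom f \<noteq> {}"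

definition rval :: "('a \<Rightarrow> ereal) \<Rightarrow> 'a \<Rightarrow> real" where
  "rval f x = real_of_ereal (f x)"

text \<open>
  The gradient is an element of the dual space. It is only meaningful at points where
  \<open>rval f\<close> is differentiable.
\<close>

definition nabla :: "('a::real_normed_vector \<Rightarrow> ereal) \<Rightarrow> 'a \<Rightarrow> ('a \<Rightarrow>\<^sub>L real)" where
  "nabla f x = (THE D. (rval f has_derivative blinfun_apply D) (at x))"

definition strongly_convex_one :: "('a::real_normed_vector \<Rightarrow> ereal) \<Rightarrow> bool" where
  "strongly_convex_one d \<longleftrightarrow>
     (\<forall>x\<in>interior (edom d). \<forall>y\<in>edom d.
        rval d y \<ge> rval d x + blinfun_apply (nabla d x) (y - x) + 1/2 * (norm (y - x))\<^sup>2)"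

definition Phi ::
  "('a::real_normed_vector \<Rightarrow> ereal) \<Rightarrow> ('a \<Rightarrow> ereal) \<Rightarrow> real \<Rightarrow> ('a \<Rightarrow>\<^sub>L real) \<Rightarrow> real" where
  "Phi d \<psi> L s = (SUP y\<in>edom \<psi>. blinfun_apply s y - L * rval d y - rval \<psi> y)"

definition G_map ::
  "('a::real_normed_vector \<Rightarrow> ereal) \<Rightarrow> ('m::finite \<Rightarrow> 'a) \<Rightarrow> real ^ 'm \<Rightarrow> ('a \<Rightarrow>\<^sub>L real)" where
  "G_map f z lam = (\<Sum>i\<in>UNIV. (lam $ i) *\<^sub>R nabla f (z i))"

definition f_star ::
  "('a::real_normed_vector \<Rightarrow> ereal) \<Rightarrow> ('m::finite \<Rightarrow> 'a) \<Rightarrow> real ^ 'm" where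
  "f_star f z = (\<chi> i. blinfun_apply (nabla f (z i)) (z i) - rval f (z i))"

definition xi ::
  "('a::real_normed_vector \<Rightarrow> ereal) \<Rightarrow> ('a \<Rightarrow> ereal) \<Rightarrow> ('a \<Rightarrow> ereal) \<Rightarrow> real \<Rightarrow> 'a
    \<Rightarrow> ('m::finite \<Rightarrow> 'a) \<Rightarrow> real ^ 'm \<Rightarrow> real" where
  "xi d f \<psi> L xbar z lam =
     Phi d \<psi> L (L *\<^sub>R nabla d xbar - G_map f z lam) + lam \<bullet> f_star f z
       + L * (rval d xbar - blinfun_apply (nabla d xbar) xbar)"

definition grad :: "('v::real_inner \<Rightarrow> real) \<Rightarrow> 'v \<Rightarrow> 'v" where
  "grad F x = (THE D. GDERIV F x :> D)"

definition std_simplex :: "(real ^ 'm::finite) set" where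
  "std_simplex = {lam. (\<forall>i. 0 \<le> lam $ i) \<and> (\<Sum>i\<in>UNIV. lam $ i) = 1}"

definition frank_wolfe ::
  "(real ^ 'm::finite \<Rightarrow> real) \<Rightarrow> (nat \<Rightarrow> 'm) \<Rightarrow> (nat \<Rightarrow> real ^ 'm) \<Rightarrow> bool" where
  "frank_wolfe F i lam \<longleftrightarrow>
     lam 0 = (\<chi> j. 1 / real CARD('m)) \<and>
     (\<forall>k. is_arg_min (\<lambda>j. grad F (lam k) $ j) (\<lambda>_. True) (i k) \<and>
          lam (Suc k) = (real k / (real k + 2)) *\<^sub>R lam k + (2 / (real k + 2)) *\<^sub>R axis (i k) 1)"

definition fw_gap :: "(real ^ 'm::finite \<Rightarrow> real) \<Rightarrow> real ^ 'm \<Rightarrow> real" where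
  "fw_gap F lbar = (SUP lam\<in>std_simplex. grad F lbar \<bullet> (lbar - lam))"

end

theory Submission
  imports Defs
begin

text \<open>
  Up to an affine term, \<open>\<xi>\<^sub>L\<close> is the conjugate of \<open>L d + \<psi>\<close> composed with the linear map
  \<open>\<lambda> \<mapsto> - G \<lambda>\<close>. Since \<open>L d + \<psi>\<close> is strongly convex with parameter \<open>L\<close>, its conjugate lies
  above each of its linearisations and exceeds it by at most \<open>\<parallel>s' - s\<parallel>\<^sup>2 / (2 L)\<close>
  (\<open>conjugate_quadratic_bounds\<close>). Hence \<open>\<xi>\<^sub>L\<close> is convex and differentiable, with remainder at
  most \<open>\<parallel>G (\<lambda>' - \<lambda>)\<parallel>\<^sup>2 / (2 L)\<close> (\<open>xi_quadratic_bounds\<close>). On the simplex both \<open>G e\<^sub>j\<close> and \<open>G \<lambda>\<close>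
  are convex combinations of the \<open>g\<^sub>i\<close>, so moving from \<open>\<lambda>\<close> a fraction \<open>t\<close> of the way to a vertex
  costs a second-order term of at most \<open>C t\<^sup>2 / 2\<close> with \<open>C = 4 max \<parallel>g\<^sub>i\<parallel>\<^sup>2 / L\<close>.

  With \<open>\<gamma>\<^sub>k = 2 / (k + 2)\<close> one Frank-Wolfe step therefore gives
  \<open>h\<^sub>k\<^sub>+\<^sub>1 \<le> h\<^sub>k - \<gamma>\<^sub>k \<delta>\<^sub>k + C \<gamma>\<^sub>k\<^sup>2 / 2\<close> for the objective gap \<open>h\<^sub>k\<close> and the duality gap \<open>\<delta>\<^sub>k\<close>, and
  convexity gives \<open>h\<^sub>k \<le> \<delta>\<^sub>k\<close>. The two together yield the usual rate \<open>h\<^sub>k \<le> 2 C / (k + 2)\<close>.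
  Starting from this rate at \<open>k = \<lceil>T / 2\<rceil>\<close> and adding the step inequalities up to \<open>k = T\<close> bounds
  the smallest \<open>\<delta>\<^sub>k\<close> by \<open>9 C / (2 T)\<close> (\<open>frank_wolfe_recursion\<close>), which is the claim.
\<close>

section \<open>Compactness in finite-dimensional normed spaces\<close>

text \<open>
  When a vector \<open>b\<close> outside the span of \<open>B\<close> is added, the induction hypothesis makes that span
  closed, so \<open>b\<close> has positive distance from it. This distance bounds the \<open>b\<close>-coefficients of a
  bounded sequence, and the coefficients and the remaining parts converge along a subsequence.
\<close>

lemma span_bounded_seq_convergent_subseq:
  fixes B :: "'a::real_normed_vector set" and X :: "nat \<Rightarrow> 'a"
  assumes "finite B" "bounded (range X)" "\<And>n. X n \<in> span B"
  shows "\<exists>l\<in>span B. \<exists>r. strict_mono r \<and> (X \<circ> r) \<longlonglongrightarrow> l"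
  using assms
proof (induction B arbitrary: X rule: finite_induct)
  case empty
  then have "X = (\<lambda>n. 0)" by auto
  then have "(X \<circ> id) \<longlonglongrightarrow> 0" by (simp add: o_def)
  then show ?case using strict_mono_id by (auto intro: span_zero)
next
  case (insert b B)
  show ?case
  proof (cases "b \<in> span B")
    case True
    then have "span (insert b B) = span B" by (rule span_redundant)
    then show ?thesis using insert by simp
  next
    case False
    have closed: "closed (span B)"
      unfolding closed_sequential_limits
    proof (intro allI impI, elim conjE)
      fix Y l assume Y: "\<forall>n. Y n \<in> span B" "Y \<longlonglongrightarrow> l"
      then have "bounded (range Y)" by (blast intro: convergent_imp_bounded)
      then obtain l' r where l': "l' \<in> span B" "strict_mono r" "(Y \<circ> r) \<longlonglongrightarrow> l'"
        using insert.IH Y by metis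
      with Y have "l = l'" by (metis LIMSEQ_subseq_LIMSEQ LIMSEQ_unique)
      with l' show "l \<in> span B" by simp
    qed
    define \<delta> where "\<delta> = infdist b (span B)"
    have "\<delta> > 0"
      unfolding \<delta>_def using closed False span_zero by (intro infdist_pos_not_in_closed) auto
    have coeff_bound: "\<bar>t\<bar> * \<delta> \<le> norm x" if "x - t *\<^sub>R b \<in> span B" for t x
    proof (cases "t = 0")
      case False
      have "(- (1 / t)) *\<^sub>R (x - t *\<^sub>R b) \<in> span B" using that by (rule span_scale)
      then have "\<delta> \<le> dist b ((- (1 / t)) *\<^sub>R (x - t *\<^sub>R b))"
        unfolding \<delta>_def by (rule infdist_le)
      also have "\<dots> = norm x / \<bar>t\<bar>"
        using False by (simp add: dist_norm scaleR_diff_right)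
      finally show ?thesis using False by (simp add: field_simps)
    qed simp
    have "\<forall>n. \<exists>k. X n - k *\<^sub>R b \<in> span B"
      using insert.prems(2) by (simp add: span_breakdown_eq)
    then obtain k where k: "\<And>n. X n - k n *\<^sub>R b \<in> span B" by metis
    obtain M where M: "\<And>n. norm (X n) \<le> M"
      using insert.prems(1) by (auto simp: bounded_iff)
    have "\<bar>k n\<bar> \<le> M / \<delta>" for n
      using coeff_bound[OF k[of n]] M[of n] \<open>\<delta> > 0\<close> by (simp add: field_simps)
    then have bk: "bounded (range k)" by (auto simp: bounded_iff)
    then obtain r1 a where r1: "strict_mono r1" "(k \<circ> r1) \<longlonglongrightarrow> a"
      using bounded_imp_convergent_subsequence by blast
    have "bounded (range (\<lambda>n. X n - k n *\<^sub>R b))"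
    proof (intro bounded_minus_comp insert.prems(1))
      show "bounded (range (\<lambda>n. k n *\<^sub>R b))"
        using bounded_linear_image[OF bk bounded_linear_scaleR_left[of b]]
        by (simp add: image_image)
    qed
    then have "bounded (range ((\<lambda>n. X n - k n *\<^sub>R b) \<circ> r1))"
      by (rule bounded_subset) auto
    then obtain w r2 where r2: "w \<in> span B" "strict_mono r2"
        "((\<lambda>n. X n - k n *\<^sub>R b) \<circ> r1 \<circ> r2) \<longlonglongrightarrow> w"
      using insert.IH[of "(\<lambda>n. X n - k n *\<^sub>R b) \<circ> r1"] k unfolding o_apply by metis
    have "(\<lambda>n. (k \<circ> r1 \<circ> r2) n *\<^sub>R b + ((\<lambda>n. X n - k n *\<^sub>R b) \<circ> r1 \<circ> r2) n)
          \<longlonglongrightarrow> a *\<^sub>R b + w"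
      by (intro tendsto_intros r2(3) LIMSEQ_subseq_LIMSEQ[OF r1(2) r2(2)])
    then have "(X \<circ> (r1 \<circ> r2)) \<longlonglongrightarrow> a *\<^sub>R b + w" by (simp add: o_def)
    moreover have "a *\<^sub>R b + w \<in> span (insert b B)"
      using r2(1) by (auto simp: span_breakdown_eq intro!: exI[of _ a])
    ultimately show ?thesis using strict_mono_o[OF r1(1) r2(2)] by blast
  qed
qed

lemma finite_dimensional_bounded_seq:
  fixes X :: "nat \<Rightarrow> 'a::real_normed_vector"
  assumes "finite_dimensional TYPE('a)" "bounded (range X)"
  obtains l r where "strict_mono r" "(X \<circ> r) \<longlonglongrightarrow> l"
  using assms span_bounded_seq_convergent_subseq[of _ X]
  unfolding finite_dimensional_def by (metis UNIV_I)

section \<open>Closed convex and strongly convex functions\<close>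

lemma closed_convex_rval:
  assumes "closed_convex p" "x \<in> edom p"
  shows "p x = ereal (rval p x)"
  using assms by (cases "p x") (auto simp: closed_convex_def edom_def rval_def)

text \<open>
  Otherwise a sequence in \<open>S\<close> along which \<open>p\<close> tends to \<open>-\<infinity>\<close> has a limit point, and closedness
  of the epigraph forces the value \<open>-\<infinity>\<close> there.
\<close>

lemma closed_convex_bounded_below:
  fixes p :: "'a::real_normed_vector \<Rightarrow> ereal"
  assumes fin: "finite_dimensional TYPE('a)" and p: "closed_convex p"
    and S: "bounded S" "S \<subseteq> edom p"
  shows "\<exists>m. \<forall>x\<in>S. m \<le> rval p x"
proof (rule ccontr)
  assume "\<not> ?thesis"
  then have "\<forall>n::nat. \<exists>x\<in>S. rval p x < - real n" by (meson not_le)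
  then obtain X where X: "\<And>n. X n \<in> S" "\<And>n. rval p (X n) < - real n" by metis
  have "bounded (range X)" using S(1) by (rule bounded_subset) (use X in auto)
  then obtain l r where r: "strict_mono r" "(X \<circ> r) \<longlonglongrightarrow> l"
    using finite_dimensional_bounded_seq[OF fin] by blast
  have "p l \<le> ereal t" for t
  proof -
    obtain N where N: "- t \<le> real N" using real_arch_simple by blast
    have mem: "(X (r (n + N)), t) \<in> epigraph p" for n
    proof -
      have "N \<le> r (n + N)" using seq_suble[OF r(1), of "n + N"] by simp
      then have "rval p (X (r (n + N))) \<le> t"
        using X(2)[of "r (n + N)"] N by linarith
      moreover have "p (X (r (n + N))) = ereal (rval p (X (r (n + N))))"
        using X(1) S(2) by (intro closed_convex_rval[OF p]) blast
      ultimately show ?thesis by (simp add: epigraph_def)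
    qed
    have lim: "(\<lambda>n. (X (r (n + N)), t)) \<longlonglongrightarrow> (l, t)"
      using LIMSEQ_ignore_initial_segment[OF r(2), of N]
      by (intro tendsto_Pair) (simp_all add: o_def)
    have "closed (epigraph p)" using p by (simp add: closed_convex_def)
    then have "(l, t) \<in> epigraph p"
      by (rule closed_sequentially[of _ "\<lambda>n. (X (r (n + N)), t)"]) (use mem lim in auto)
    then show ?thesis by (simp add: epigraph_def)
  qed
  then have "p l = -\<infinity>" by (rule ereal_bot)
  with p show False by (simp add: closed_convex_def)
qed

lemma closed_convex_convex_on:
  fixes p :: "'a::real_normed_vector \<Rightarrow> ereal"
  assumes p: "closed_convex p"
  shows "convex_on (edom p) (rval p)"
proof -
  have conv: "convex (epigraph p)" using p by (simp add: closed_convex_def)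
  have key: "p ((1 - t) *\<^sub>R x + t *\<^sub>R y) \<le> ereal ((1 - t) * rval p x + t * rval p y)"
    if "x \<in> edom p" "y \<in> edom p" "0 \<le> t" "t \<le> 1" for x y t
  proof -
    have "(x, rval p x) \<in> epigraph p" "(y, rval p y) \<in> epigraph p"
      using closed_convex_rval[OF p] that by (auto simp: epigraph_def)
    then have "(1 - t) *\<^sub>R (x, rval p x) + t *\<^sub>R (y, rval p y) \<in> epigraph p"
      using conv that unfolding convex_alt by blast
    then show ?thesis by (simp add: epigraph_def)
  qed
  have mem: "(1 - t) *\<^sub>R x + t *\<^sub>R y \<in> edom p"
    if "x \<in> edom p" "y \<in> edom p" "0 \<le> t" "t \<le> 1" for x y t
    using key[OF that] by (auto simp: edom_def)
  show ?thesis
  proof (rule convex_onI)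
    show "convex (edom p)" unfolding convex_alt using mem by blast
    fix t x y assume "0 < t" "t < (1::real)" "x \<in> edom p" "y \<in> edom p"
    then show "rval p ((1 - t) *\<^sub>R x + t *\<^sub>R y) \<le> (1 - t) * rval p x + t * rval p y"
      using key[of x y t] closed_convex_rval[OF p mem[of x y t]] by simp
  qed
qed

text \<open>
  This form of strong convexity involves no gradient, so it survives the addition of a
  nonsmooth convex function such as \<open>\<psi>\<close>.
\<close>

definition strongly_convex_on :: "real \<Rightarrow> 'a::real_normed_vector set \<Rightarrow> ('a \<Rightarrow> real) \<Rightarrow> bool"
  where "strongly_convex_on L Q h \<longleftrightarrow> convex Q \<and>
    (\<forall>x\<in>Q. \<forall>y\<in>Q. \<forall>t\<in>{0..1}. h ((1 - t) *\<^sub>R x + t *\<^sub>R y)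
       \<le> (1 - t) * h x + t * h y - L / 2 * (t * (1 - t)) * (norm (x - y))\<^sup>2)"

text \<open>
  The convex conjugate of the function that equals \<open>h\<close> on \<open>Q\<close> and \<open>+\<infinity>\<close> elsewhere. As for every
  real supremum, its value carries information only for a set that is bounded above.
\<close>

definition conjugate :: "'a::real_normed_vector set \<Rightarrow> ('a \<Rightarrow> real) \<Rightarrow> ('a \<Rightarrow>\<^sub>L real) \<Rightarrow> real"
  where "conjugate Q h s = (SUP y\<in>Q. blinfun_apply s y - h y)"

text \<open>
  The gradient inequality is applied at the intermediate point \<open>w\<close>, towards each of the two
  end points; in the weighted sum the gradient terms cancel.
\<close>

lemma strongly_convex_one_imp_on:
  assumes d: "strongly_convex_one d" and Q: "convex Q" "Q \<subseteq> interior (edom d)"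
  shows "strongly_convex_on 1 Q (rval d)"
  unfolding strongly_convex_on_def
proof (intro conjI Q(1) ballI)
  fix x y and t :: real assume x: "x \<in> Q" and y: "y \<in> Q" and t: "t \<in> {0..1}"
  define w where "w = (1 - t) *\<^sub>R x + t *\<^sub>R y"
  define D where "D = blinfun_apply (nabla d w)"
  have w: "w \<in> interior (edom d)"
    using Q x y t unfolding convex_alt w_def by auto
  have wx: "x - w = t *\<^sub>R (x - y)" and wy: "y - w = (1 - t) *\<^sub>R (y - x)"
    unfolding w_def by (simp_all add: algebra_simps)
  have mem: "x \<in> edom d" "y \<in> edom d" using Q(2) x y interior_subset by blast+
  have "rval d x \<ge> rval d w + t * D (x - y) + 1/2 * (t * norm (x - y))\<^sup>2"
    using d w mem(1) t unfolding strongly_convex_one_def D_def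
    by (fastforce simp: wx blinfun.scaleR_right)
  then have 1: "(1 - t) * (rval d w + t * D (x - y) + 1/2 * (t * norm (x - y))\<^sup>2)
       \<le> (1 - t) * rval d x"
    using t by (intro mult_left_mono) auto
  have "rval d y \<ge> rval d w + (1 - t) * D (y - x) + 1/2 * ((1 - t) * norm (y - x))\<^sup>2"
    using d w mem(2) t unfolding strongly_convex_one_def D_def
    by (fastforce simp: wy blinfun.scaleR_right)
  moreover have "D (y - x) = - D (x - y)"
    unfolding D_def by (simp add: blinfun.diff_right)
  ultimately have 2: "t * (rval d w - (1 - t) * D (x - y) + 1/2 * ((1 - t) * norm (x - y))\<^sup>2)
       \<le> t * rval d y"
    using t by (intro mult_left_mono) (auto simp: norm_minus_commute)
  have "(1 - t) * (rval d w + t * D (x - y) + 1/2 * (t * norm (x - y))\<^sup>2)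
      + t * (rval d w - (1 - t) * D (x - y) + 1/2 * ((1 - t) * norm (x - y))\<^sup>2)
      = rval d w + 1/2 * (t * (1 - t)) * (norm (x - y))\<^sup>2"
    by (simp add: field_simps power2_eq_square)
  with 1 2 show "rval d ((1 - t) *\<^sub>R x + t *\<^sub>R y)
       \<le> (1 - t) * rval d x + t * rval d y - 1/2 * (t * (1 - t)) * (norm (x - y))\<^sup>2"
    unfolding w_def[symmetric] by linarith
qed

lemma strongly_convex_on_combine:
  assumes h: "strongly_convex_on 1 Q h" and p: "convex_on Q p" and L: "L \<ge> 0"
  shows "strongly_convex_on L Q (\<lambda>y. L * h y + p y)"
  unfolding strongly_convex_on_def
proof (intro conjI ballI)
  show "convex Q" using h by (simp add: strongly_convex_on_def)
  fix x y and t :: real assume x: "x \<in> Q" and y: "y \<in> Q" and t: "t \<in> {0..1}"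
  have "L * h ((1 - t) *\<^sub>R x + t *\<^sub>R y)
      \<le> L * ((1 - t) * h x + t * h y - 1 / 2 * (t * (1 - t)) * (norm (x - y))\<^sup>2)"
    using h x y t L unfolding strongly_convex_on_def by (intro mult_left_mono) auto
  moreover have "p ((1 - t) *\<^sub>R x + t *\<^sub>R y) \<le> (1 - t) * p x + t * p y"
    using convex_onD[OF p] x y t by auto
  ultimately show "L * h ((1 - t) *\<^sub>R x + t *\<^sub>R y) + p ((1 - t) *\<^sub>R x + t *\<^sub>R y)
      \<le> (1 - t) * (L * h x + p x) + t * (L * h y + p y) - L / 2 * (t * (1 - t)) * (norm (x - y))\<^sup>2"
    by (simp add: algebra_simps)
qed

section \<open>The conjugate of a strongly convex function\<close>

lemma strongly_convex_on_tilt: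
  assumes "strongly_convex_on L Q h" "x \<in> Q" "y \<in> Q" "0 \<le> t" "t \<le> 1"
  shows "(1 - t) * (blinfun_apply s x - h x) + t * (blinfun_apply s y - h y)
      + L / 2 * (t * (1 - t)) * (norm (x - y))\<^sup>2
    \<le> blinfun_apply s ((1 - t) *\<^sub>R x + t *\<^sub>R y) - h ((1 - t) *\<^sub>R x + t *\<^sub>R y)"
proof -
  have "h ((1 - t) *\<^sub>R x + t *\<^sub>R y)
       \<le> (1 - t) * h x + t * h y - L / 2 * (t * (1 - t)) * (norm (x - y))\<^sup>2"
    using assms unfolding strongly_convex_on_def by auto
  then show ?thesis
    by (simp add: blinfun.add_right blinfun.scaleR_right right_diff_distrib)
qed

text \<open>
  A bound near one point suffices: if \<open>y\<close> has distance \<open>r > 1\<close> from \<open>c\<close>, the point at distance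
  one on the segment from \<open>c\<close> to \<open>y\<close> bounds the value at \<open>y\<close> by an expression that is linear in
  \<open>r\<close> minus a term of order \<open>L r\<^sup>2 / 2\<close>.
\<close>

lemma bdd_above_conjugate:
  assumes h: "strongly_convex_on L Q h" and L: "L > 0" and c: "c \<in> Q"
    and m: "\<And>y. y \<in> Q \<Longrightarrow> norm (y - c) \<le> 1 \<Longrightarrow> m \<le> h y"
  shows "bdd_above ((\<lambda>y. blinfun_apply s y - h y) ` Q)"
proof -
  let ?\<phi> = "\<lambda>y. blinfun_apply s y - h y"
  define M where "M = norm s * (norm c + 1) - m"
  define b where "b = M - ?\<phi> c"
  have near: "?\<phi> y \<le> M" if "y \<in> Q" "norm (y - c) \<le> 1" for y
  proof -
    have "blinfun_apply s y \<le> norm s * norm y" using norm_blinfun[of s y] by simp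
    also have "\<dots> \<le> norm s * (norm c + 1)"
      using that(2) norm_triangle_sub[of y c] by (intro mult_left_mono) auto
    finally show ?thesis using m[OF that] unfolding M_def by simp
  qed
  show ?thesis
  proof (rule bdd_aboveI2)
    fix y assume y: "y \<in> Q"
    show "?\<phi> y \<le> M + b\<^sup>2 / (2 * L)"
    proof (cases "norm (y - c) \<le> 1")
      case True
      with near[OF y] L show ?thesis by (simp add: add_increasing2)
    next
      case False
      define r where "r = norm (y - c)"
      have r: "r > 1" using False by (simp add: r_def)
      define w where "w = (1 - 1 / r) *\<^sub>R c + (1 / r) *\<^sub>R y"
      have "w - c = (1 / r) *\<^sub>R (y - c)" unfolding w_def by (simp add: algebra_simps)
      then have "norm (w - c) \<le> 1" using r by (simp add: r_def)
      moreover have "w \<in> Q"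
        using h c y r unfolding strongly_convex_on_def convex_alt w_def by auto
      ultimately have "?\<phi> w \<le> M" by (rule near[rotated])
      moreover have "(1 - 1 / r) * ?\<phi> c + (1 / r) * ?\<phi> y
          + L / 2 * ((1 / r) * (1 - 1 / r)) * r\<^sup>2 \<le> ?\<phi> w"
        using strongly_convex_on_tilt[OF h c y, of "1 / r" s] r
        unfolding w_def by (simp add: r_def norm_minus_commute[of c] divide_le_eq)
      ultimately have "(1 - 1 / r) * ?\<phi> c + (1 / r) * ?\<phi> y
          + L / 2 * ((1 / r) * (1 - 1 / r)) * r\<^sup>2 \<le> M" by linarith
      then have "r * ((1 - 1 / r) * ?\<phi> c + (1 / r) * ?\<phi> y
          + L / 2 * ((1 / r) * (1 - 1 / r)) * r\<^sup>2) \<le> r * M"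
        using r by (intro mult_left_mono) auto
      moreover have "r * ((1 - 1 / r) * ?\<phi> c + (1 / r) * ?\<phi> y
          + L / 2 * ((1 / r) * (1 - 1 / r)) * r\<^sup>2)
          = (r - 1) * ?\<phi> c + ?\<phi> y + L / 2 * (r - 1) * r"
        using r by (simp add: field_simps power2_eq_square)
      ultimately have "?\<phi> y \<le> M + ((r - 1) * b - L / 2 * (r - 1) * r)"
        unfolding b_def by (simp add: algebra_simps)
      also have "(r - 1) * b - L / 2 * (r - 1) * r \<le> (r - 1) * b - L / 2 * (r - 1)\<^sup>2"
        using r L by (simp add: power2_eq_square mult_left_mono)
      also have "\<dots> \<le> b\<^sup>2 / (2 * L)"
      proof -
        have "0 \<le> (L * (r - 1) - b)\<^sup>2" by simp
        then show ?thesis using L by (simp add: field_simps power2_eq_square)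
      qed
      finally show ?thesis by simp
    qed
  qed
qed

text \<open>
  The gradient \<open>y\<close> of the conjugate at \<open>s\<close> is found as the limit of a maximizing sequence of
  \<open>\<phi> = s - h\<close>. Passing to the limit in strong concavity shows that \<open>\<phi>\<close> falls off at least like
  \<open>L / 2 \<parallel>y - x\<parallel>\<^sup>2\<close> below its supremum. A change of \<open>s\<close> by \<open>u\<close> then gains at most
  \<open>u y + \<parallel>u\<parallel> r - L r\<^sup>2 / 2\<close> at distance \<open>r\<close> from \<open>y\<close>, which is largest at \<open>r = \<parallel>u\<parallel> / L\<close>.
\<close>

lemma conjugate_quadratic_bounds:
  fixes h :: "'a::real_normed_vector \<Rightarrow> real"
  assumes fin: "finite_dimensional TYPE('a)"
    and h: "strongly_convex_on L Q h" and L: "L > 0" and ne: "Q \<noteq> {}"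
    and bdd: "\<And>s. bdd_above ((\<lambda>y. blinfun_apply s y - h y) ` Q)"
  shows "\<exists>y. \<forall>s'. conjugate Q h s + blinfun_apply (s' - s) y \<le> conjugate Q h s' \<and>
     conjugate Q h s' \<le> conjugate Q h s + blinfun_apply (s' - s) y + (norm (s' - s))\<^sup>2 / (2 * L)"
proof -
  let ?\<phi> = "\<lambda>y. blinfun_apply s y - h y"
  define V where "V = conjugate Q h s"
  have upper: "blinfun_apply u y - h y \<le> conjugate Q h u" if "y \<in> Q" for u y
    unfolding conjugate_def using that bdd by (intro cSUP_upper)
  have "\<exists>x\<in>Q. V - 1 / (real n + 1) < ?\<phi> x" for n
    using less_cSUP_iff[OF ne bdd[of s], of "V - 1 / (real n + 1)"]
    by (simp add: V_def conjugate_def)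
  then obtain X where XQ: "\<And>n. X n \<in> Q" and X: "\<And>n. V - 1 / (real n + 1) < ?\<phi> (X n)"
    by metis
  \<comment> \<open>The midpoint of two near-maximizers has value at most \<open>V\<close>, so they cannot be far apart.\<close>
  have "X n \<in> cball (X 0) (sqrt (8 / L))" for n
  proof -
    have "?\<phi> ((1 - 1/2) *\<^sub>R X 0 + (1/2) *\<^sub>R X n) \<le> V"
      unfolding V_def
    proof (rule upper)
      show "(1 - 1/2) *\<^sub>R X 0 + (1/2) *\<^sub>R X n \<in> Q"
        using h XQ by (intro convexD) (auto simp: strongly_convex_on_def)
    qed
    then have "(1/2) * ?\<phi> (X 0) + (1/2) * ?\<phi> (X n) + L / 8 * (norm (X 0 - X n))\<^sup>2 \<le> V"
      using strongly_convex_on_tilt[OF h XQ[of 0] XQ[of n], of "1/2" s] by simp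
    moreover have "V - 1 \<le> ?\<phi> (X k)" for k
    proof -
      have "1 / (real k + 1) \<le> 1" by simp
      then show ?thesis using X[of k] by linarith
    qed
    note this[of 0] this[of n]
    ultimately have "L / 8 * (norm (X 0 - X n))\<^sup>2 \<le> 1" by argo
    then have "(norm (X 0 - X n))\<^sup>2 \<le> 8 / L" using L by (simp add: field_simps)
    then show ?thesis by (simp add: dist_norm real_le_rsqrt)
  qed
  then have "bounded (range X)" by (meson bounded_cball bounded_subset image_subsetI)
  then obtain ystar r where r: "strict_mono r" "(X \<circ> r) \<longlonglongrightarrow> ystar"
    using finite_dimensional_bounded_seq[OF fin] by blast
  define Y where "Y = X \<circ> r"
  have YQ: "Y n \<in> Q" for n using XQ by (simp add: Y_def)
  have Ylim: "Y \<longlonglongrightarrow> ystar" using r by (simp add: Y_def)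
  have \<phi>lim: "(\<lambda>n. ?\<phi> (Y n)) \<longlonglongrightarrow> V"
  proof (rule tendsto_sandwich)
    show "\<forall>\<^sub>F n in sequentially. V - 1 / (real (Suc n)) \<le> ?\<phi> (Y n)"
    proof (intro always_eventually allI)
      fix n
      have "1 / (real (r n) + 1) \<le> 1 / real (Suc n)"
        using seq_suble[OF r(1), of n] by (intro divide_left_mono) auto
      then show "V - 1 / (real (Suc n)) \<le> ?\<phi> (Y n)"
        using X[of "r n"] by (simp add: Y_def)
    qed
    show "\<forall>\<^sub>F n in sequentially. ?\<phi> (Y n) \<le> V"
      using upper[OF YQ] by (simp add: V_def)
    have "(\<lambda>n. V - 1 / real (Suc n)) \<longlonglongrightarrow> V - 0"
      using LIMSEQ_inverse_real_of_nat by (intro tendsto_intros) (simp add: inverse_eq_divide)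
    then show "(\<lambda>n. V - 1 / real (Suc n)) \<longlonglongrightarrow> V" by simp
  qed simp
  have growth: "?\<phi> y + L / 2 * (norm (ystar - y))\<^sup>2 \<le> V" if y: "y \<in> Q" for y
  proof -
    have "q * (L / 2 * (norm (ystar - y))\<^sup>2) \<le> V - ?\<phi> y" if q: "0 < q" "q < 1" for q :: real
    proof -
      define t where "t = 1 - q"
      have t: "0 < t" "t < 1" using q by (auto simp: t_def)
      have "(1 - t) * ?\<phi> (Y n) + t * ?\<phi> y + L / 2 * (t * (1 - t)) * (norm (Y n - y))\<^sup>2 \<le> V" for n
      proof -
        have "(1 - t) *\<^sub>R Y n + t *\<^sub>R y \<in> Q"
          using h YQ y t unfolding strongly_convex_on_def convex_alt by auto
        from upper[OF this, of s] strongly_convex_on_tilt[OF h YQ[of n] y, of t s] t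
        show ?thesis unfolding V_def by linarith
      qed
      moreover have "(\<lambda>n. (1 - t) * ?\<phi> (Y n) + t * ?\<phi> y + L / 2 * (t * (1 - t)) * (norm (Y n - y))\<^sup>2)
          \<longlonglongrightarrow> (1 - t) * V + t * ?\<phi> y + L / 2 * (t * (1 - t)) * (norm (ystar - y))\<^sup>2"
        by (intro tendsto_add tendsto_mult tendsto_const \<phi>lim tendsto_power tendsto_norm
            tendsto_diff Ylim)
      ultimately have "(1 - t) * V + t * ?\<phi> y + L / 2 * (t * (1 - t)) * (norm (ystar - y))\<^sup>2 \<le> V"
        by (intro LIMSEQ_le_const2) auto
      then have "t * (?\<phi> y + (1 - t) * (L / 2 * (norm (ystar - y))\<^sup>2)) \<le> t * V"
        by (simp add: algebra_simps)
      then show ?thesis using t by (simp add: t_def)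
    qed
    then have "L / 2 * (norm (ystar - y))\<^sup>2 \<le> V - ?\<phi> y" by (rule field_le_mult_one_interval)
    then show ?thesis by simp
  qed
  show ?thesis
  proof (intro exI allI conjI)
    fix s'
    have "?\<phi> (Y n) + blinfun_apply (s' - s) (Y n) \<le> conjugate Q h s'" for n
      using upper[OF YQ, of s' n] by (simp add: blinfun.diff_left)
    moreover have "(\<lambda>n. ?\<phi> (Y n) + blinfun_apply (s' - s) (Y n))
        \<longlonglongrightarrow> V + blinfun_apply (s' - s) ystar"
      by (intro tendsto_add \<phi>lim blinfun.tendsto tendsto_const Ylim)
    ultimately show "conjugate Q h s + blinfun_apply (s' - s) ystar \<le> conjugate Q h s'"
      unfolding V_def[symmetric] by (intro LIMSEQ_le_const2) auto
    show "conjugate Q h s' \<le> conjugate Q h s + blinfun_apply (s' - s) ystar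
        + (norm (s' - s))\<^sup>2 / (2 * L)"
      unfolding conjugate_def[of Q h s']
    proof (rule cSUP_least[OF ne])
      fix y assume y: "y \<in> Q"
      define a b where "a = norm (s' - s)" and "b = norm (ystar - y)"
      have "blinfun_apply (s' - s) (y - ystar) \<le> a * b"
        using norm_blinfun[of "s' - s" "y - ystar"] by (simp add: a_def b_def norm_minus_commute)
      also have "\<dots> \<le> a\<^sup>2 / (2 * L) + L / 2 * b\<^sup>2"
      proof -
        have "0 \<le> (a - L * b)\<^sup>2" by simp
        then show ?thesis using L by (simp add: field_simps power2_eq_square)
      qed
      finally have "blinfun_apply (s' - s) (y - ystar) \<le> a\<^sup>2 / (2 * L) + L / 2 * b\<^sup>2" .
      then show "blinfun_apply s' y - h y \<le> conjugate Q h s + blinfun_apply (s' - s) ystar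
          + (norm (s' - s))\<^sup>2 / (2 * L)"
        using growth[OF y] unfolding V_def a_def b_def
        by (simp add: blinfun.diff_left blinfun.diff_right)
    qed
  qed
qed

text \<open>
  The interior of \<open>dom d\<close> contains \<open>dom \<psi>\<close>, so the gradient form of strong convexity is available
  at every point of \<open>dom \<psi>\<close>.
\<close>

lemma Phi_quadratic_bounds:
  fixes d \<psi> :: "'a::real_normed_vector \<Rightarrow> ereal"
  assumes fin: "finite_dimensional TYPE('a)"
    and d: "closed_convex d" "strongly_convex_one d"
    and \<psi>: "closed_convex \<psi>" "edom \<psi> \<noteq> {}" "edom \<psi> \<subseteq> interior (edom d)"
    and L: "L > 0"
  shows "\<exists>y. \<forall>s'. Phi d \<psi> L s + blinfun_apply (s' - s) y \<le> Phi d \<psi> L s' \<and>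
      Phi d \<psi> L s' \<le> Phi d \<psi> L s + blinfun_apply (s' - s) y + (norm (s' - s))\<^sup>2 / (2 * L)"
proof -
  define h where "h = (\<lambda>y. L * rval d y + rval \<psi> y)"
  have Phi: "Phi d \<psi> L = conjugate (edom \<psi>) h"
    by (simp add: fun_eq_iff Phi_def conjugate_def h_def diff_diff_eq)
  have conv: "convex_on (edom \<psi>) (rval \<psi>)" by (rule closed_convex_convex_on[OF \<psi>(1)])
  have h: "strongly_convex_on L (edom \<psi>) h"
    unfolding h_def using conv L
    by (intro strongly_convex_on_combine strongly_convex_one_imp_on d(2) \<psi>(3))
       (auto simp: convex_on_def)
  obtain c where c: "c \<in> edom \<psi>" using \<psi>(2) by blast
  define S where "S = edom \<psi> \<inter> cball c 1"
  have S: "bounded S" "S \<subseteq> edom \<psi>" "S \<subseteq> edom d"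
    using \<psi>(3) interior_subset[of "edom d"] by (auto simp: S_def bounded_Int)
  obtain m1 m2 where m: "\<forall>x\<in>S. m1 \<le> rval d x" "\<forall>x\<in>S. m2 \<le> rval \<psi> x"
    using closed_convex_bounded_below[OF fin d(1) S(1,3)]
      closed_convex_bounded_below[OF fin \<psi>(1) S(1,2)] by blast
  have "L * m1 + m2 \<le> h y" if "y \<in> edom \<psi>" "norm (y - c) \<le> 1" for y
  proof -
    have "y \<in> S" using that by (simp add: S_def dist_norm norm_minus_commute)
    then show ?thesis using m L unfolding h_def by (intro add_mono mult_left_mono) auto
  qed
  then have "bdd_above ((\<lambda>y. blinfun_apply s y - h y) ` edom \<psi>)" for s
    by (rule bdd_above_conjugate[OF h L c])
  then show ?thesis
    unfolding Phi by (rule conjugate_quadratic_bounds[OF fin h L \<psi>(2)])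
qed

section \<open>The gradient of the dual objective\<close>

lemma GDERIV_quadratic_remainder:
  fixes F :: "'v::real_inner \<Rightarrow> real"
  assumes "\<And>y. \<bar>F y - F x - v \<bullet> (y - x)\<bar> \<le> K * (norm (y - x))\<^sup>2"
  shows "GDERIV F x :> v"
  unfolding gderiv_def has_derivative_at_within
proof (intro conjI bounded_linear_inner_left)
  have "norm ((F y - F x - (y - x) \<bullet> v) /\<^sub>R norm (y - x)) \<le> K * norm (y - x)" for y
  proof (cases "y = x")
    case False
    define n where "n = norm (y - x)"
    have "n > 0" using False by (simp add: n_def)
    have "\<bar>F y - F x - (y - x) \<bullet> v\<bar> \<le> K * n * n"
      using assms[of y] by (simp add: inner_commute n_def power2_eq_square mult.assoc)
    then have "\<bar>F y - F x - (y - x) \<bullet> v\<bar> / n \<le> K * n"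
      using \<open>n > 0\<close> by (simp add: pos_divide_le_eq)
    moreover have "norm ((F y - F x - (y - x) \<bullet> v) /\<^sub>R n)
        = \<bar>F y - F x - (y - x) \<bullet> v\<bar> / n"
      using \<open>n > 0\<close> unfolding real_norm_def real_scaleR_def abs_mult
      by (simp add: divide_inverse mult.commute)
    ultimately show ?thesis by (simp only: n_def)
  qed simp
  then have le: "\<forall>\<^sub>F y in at x.
      norm ((F y - F x - (y - x) \<bullet> v) /\<^sub>R norm (y - x)) \<le> K * norm (y - x)"
    by (intro always_eventually allI)
  have "((\<lambda>y. K * norm (y - x)) \<longlongrightarrow> K * norm (x - x)) (at x)"
    by (intro tendsto_intros)
  then have "((\<lambda>y. K * norm (y - x)) \<longlongrightarrow> 0) (at x)" by simp
  with le show "((\<lambda>y. (F y - F x - (y - x) \<bullet> v) /\<^sub>R norm (y - x)) \<longlongrightarrow> 0) (at x)"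
    by (rule Lim_null_comparison)
qed

lemma grad_eqI:
  fixes F :: "'v::real_inner \<Rightarrow> real"
  assumes "GDERIV F x :> v"
  shows "grad F x = v"
  unfolding grad_def
proof (rule the_equality)
  show "GDERIV F x :> v" by (rule assms)
  fix D assume "GDERIV F x :> D"
  then have "(\<lambda>h. h \<bullet> D) = (\<lambda>h. h \<bullet> v)"
    using assms unfolding gderiv_def by (rule has_derivative_unique)
  then show "D = v" by (metis vector_eq_ldot)
qed

lemma G_map_diff: "G_map f z (u - v) = G_map f z u - G_map f z v"
  by (simp add: G_map_def scaleR_diff_left sum_subtractf)

lemma G_map_scaleR: "G_map f z (t *\<^sub>R u) = t *\<^sub>R G_map f z u"
  by (simp add: G_map_def scaleR_sum_right)

lemma norm_G_map_le: "norm (G_map f z u) \<le> (\<Sum>j\<in>UNIV. norm (nabla f (z j))) * norm u"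
proof -
  have "norm (G_map f z u) \<le> (\<Sum>j\<in>UNIV. norm (u $ j *\<^sub>R nabla f (z j)))"
    unfolding G_map_def by (rule norm_sum)
  also have "\<dots> \<le> (\<Sum>j\<in>UNIV. norm u * norm (nabla f (z j)))"
    using component_le_norm_cart[of u] by (intro sum_mono) (simp add: mult_right_mono)
  finally show ?thesis by (simp add: sum_distrib_left mult.commute)
qed

lemma xi_quadratic_bounds:
  fixes d f \<psi> :: "'a::real_normed_vector \<Rightarrow> ereal" and z :: "'m::finite \<Rightarrow> 'a" and xbar :: 'a
  assumes Phi: "\<And>s. \<exists>y. \<forall>s'. Phi d \<psi> L s + blinfun_apply (s' - s) y \<le> Phi d \<psi> L s' \<and>
      Phi d \<psi> L s' \<le> Phi d \<psi> L s + blinfun_apply (s' - s) y + (norm (s' - s))\<^sup>2 / (2 * L)"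
    and L: "L > 0"
  defines "F \<equiv> xi d f \<psi> L xbar z"
  shows "F x + grad F x \<bullet> (u - x) \<le> F u"
    and "F u \<le> F x + grad F x \<bullet> (u - x) + (norm (G_map f z (u - x)))\<^sup>2 / (2 * L)"
proof -
  define s where "s = (\<lambda>u. L *\<^sub>R nabla d xbar - G_map f z u)"
  obtain y where y:
    "\<And>s'. Phi d \<psi> L (s x) + blinfun_apply (s' - s x) y \<le> Phi d \<psi> L s'"
    "\<And>s'. Phi d \<psi> L s' \<le> Phi d \<psi> L (s x) + blinfun_apply (s' - s x) y
        + (norm (s' - s x))\<^sup>2 / (2 * L)"
    using Phi by metis
  define v where "v = f_star f z - (\<chi> j. blinfun_apply (nabla f (z j)) y)"
  have s_diff: "s u - s x = - G_map f z (u - x)" for u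
    unfolding s_def by (simp add: G_map_diff)
  have v: "v \<bullet> u = u \<bullet> f_star f z - blinfun_apply (G_map f z u) y" for u
    unfolding v_def G_map_def
    by (simp add: inner_diff_left inner_commute inner_vec_def blinfun.sum_left
        blinfun.scaleR_left mult.commute right_diff_distrib sum_subtractf)
  have F: "F u = Phi d \<psi> L (s u) + u \<bullet> f_star f z
      + L * (rval d xbar - blinfun_apply (nabla d xbar) xbar)" for u
    by (simp add: F_def xi_def s_def)
  have lower: "F x + v \<bullet> (u - x) \<le> F u" for u
    using y(1)[of "s u"] unfolding F v s_diff
    by (simp add: inner_diff_left blinfun.minus_left)
  have upper: "F u \<le> F x + v \<bullet> (u - x) + (norm (G_map f z (u - x)))\<^sup>2 / (2 * L)" for u
    using y(2)[of "s u"] unfolding F v s_diff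
    by (simp add: inner_diff_left blinfun.minus_left)
  define B where "B = (\<Sum>j\<in>UNIV. norm (nabla f (z j)))"
  have "\<bar>F u - F x - v \<bullet> (u - x)\<bar> \<le> B\<^sup>2 / (2 * L) * (norm (u - x))\<^sup>2" for u
  proof -
    have "(norm (G_map f z (u - x)))\<^sup>2 \<le> (B * norm (u - x))\<^sup>2"
      using norm_G_map_le unfolding B_def by (intro power_mono) auto
    then have "(norm (G_map f z (u - x)))\<^sup>2 / (2 * L) \<le> B\<^sup>2 / (2 * L) * (norm (u - x))\<^sup>2"
      using L by (simp add: divide_right_mono power_mult_distrib)
    with lower[of u] upper[of u] show ?thesis by linarith
  qed
  then have "grad F x = v" by (intro grad_eqI GDERIV_quadratic_remainder)
  then show "F x + grad F x \<bullet> (u - x) \<le> F u"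
    and "F u \<le> F x + grad F x \<bullet> (u - x) + (norm (G_map f z (u - x)))\<^sup>2 / (2 * L)"
    using lower upper by simp_all
qed

section \<open>The rate of the Frank-Wolfe method\<close>

text \<open>
  Pairing \<open>k\<close> with \<open>T + K - k\<close> and using \<open>1 / a + 1 / b \<ge> 4 / (a + b)\<close> replaces the logarithm of
  the harmonic sum by a rational bound, sharp enough for the constant needed below.
\<close>

lemma sum_inverse_lower:
  fixes K T :: nat
  assumes "K \<le> T"
  shows "2 * (real T + 1 - real K) / (real K + real T + 4) \<le> (\<Sum>k=K..T. 1 / (real k + 2))"
proof -
  define c where "c = real K + real T + 4"
  have "2 * (\<Sum>k=K..T. 1 / (real k + 2))
      = (\<Sum>k=K..T. 1 / (real k + 2)) + (\<Sum>k=K..T. 1 / (real (T + K - k) + 2))"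
    using sum.atLeastAtMost_rev[of "\<lambda>k. 1 / (real k + 2)" K T] by simp
  also have "\<dots> = (\<Sum>k=K..T. 1 / (real k + 2) + 1 / (real (T + K - k) + 2))"
    by (simp add: sum.distrib)
  also have "\<dots> \<ge> (\<Sum>k=K..T. 4 / c)"
  proof (rule sum_mono)
    fix k assume k: "k \<in> {K..T}"
    define a b where "a = real k + 2" and "b = real (T + K - k) + 2"
    have ab: "a > 0" "b > 0" "a + b = c" using k by (auto simp: a_def b_def c_def of_nat_diff)
    have "4 * (a * b) \<le> (a + b) * (a + b)"
      using zero_le_square[of "a - b"] by (simp add: algebra_simps)
    then have "4 / (a + b) \<le> 1 / a + 1 / b"
      using ab(1,2) by (simp add: field_simps)
    then show "4 / c \<le> 1 / (real k + 2) + 1 / (real (T + K - k) + 2)"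
      using ab(3) by (simp add: a_def b_def)
  qed
  finally have "(real T + 1 - real K) * (4 / c) \<le> 2 * (\<Sum>k=K..T. 1 / (real k + 2))"
    using assms by (simp add: of_nat_diff add.commute)
  moreover have "(real T + 1 - real K) * (4 / c) = 2 * (2 * (real T + 1 - real K) / c)" by simp
  ultimately show ?thesis unfolding c_def[symmetric] by linarith
qed

lemma sum_inverse_square_upper:
  fixes K T :: nat
  assumes "K \<le> T"
  shows "(\<Sum>k=K..T. 1 / (real k + 2)\<^sup>2) \<le> 1 / (real K + 1) - 1 / (real T + 2)"
  using assms
proof (induction T rule: dec_induct)
  have 1: "1 / (real k + 2)\<^sup>2 \<le> 1 / (real k + 1) - 1 / (real k + 2)" for k :: nat
  proof -
    have "1 / (real k + 2)\<^sup>2 \<le> 1 / ((real k + 1) * (real k + 2))"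
      by (intro divide_left_mono) (auto simp: power2_eq_square)
    also have "\<dots> = 1 / (real k + 1) - 1 / (real k + 2)" by (simp add: divide_simps)
    finally show ?thesis .
  qed
  case base
  show ?case using 1 by simp
  case (step T)
  then show ?case using 1[of "Suc T"] by (simp add: add_ac)
qed

text \<open>
  The first step has step size one, hence \<open>h 1 \<le> C / 2\<close> whatever \<open>h 0\<close> is; from there induction
  gives the rate \<open>h k \<le> 2 C / (k + 2)\<close>. Adding the step inequalities over a window \<open>K..T\<close>
  telescopes \<open>h\<close> and bounds \<open>D\<close> by about \<open>(4 / K - 2 / T) C\<close> divided by
  \<open>4 (T - K) / (T + K)\<close>. For \<open>K = T / 2\<close> this is \<open>9 C / (2 T)\<close>; rounding \<open>K\<close> up for odd \<open>T\<close>
  keeps \<open>K \<ge> 1\<close>, where the rate holds.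
\<close>

lemma frank_wolfe_recursion:
  fixes h \<delta> :: "nat \<Rightarrow> real" and C D :: real
  assumes step: "\<And>k. k \<le> T \<Longrightarrow>
      h (Suc k) \<le> h k - 2 / (real k + 2) * \<delta> k + 2 * C / (real k + 2)\<^sup>2"
    and gap: "\<And>k. k \<le> T \<Longrightarrow> h k \<le> \<delta> k"
    and h_end: "0 \<le> h (Suc T)" and C: "0 \<le> C" and T: "T \<ge> 1"
    and D: "\<And>k. k \<le> T \<Longrightarrow> D \<le> \<delta> k"
  shows "D \<le> 9 * C / (2 * real T)"
proof (cases "D \<le> 0")
  case True
  then show ?thesis using C by (smt (verit) divide_nonneg_nonneg of_nat_0_le_iff)
next
  case False
  have rate: "k \<le> T \<Longrightarrow> h (Suc k) \<le> 2 * C / (real k + 3)" for k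
  proof (induction k)
    case 0
    then show ?case using step[of 0] gap[of 0] C by (simp add: power2_eq_square)
  next
    case (Suc k)
    define q where "q = real k + 3"
    have q: "q \<ge> 3" by (simp add: q_def)
    have "2 / q * h (Suc k) \<le> 2 / q * \<delta> (Suc k)"
      using gap Suc.prems q by (intro mult_left_mono) auto
    then have "h (Suc (Suc k)) \<le> (1 - 2 / q) * h (Suc k) + 2 * C / q\<^sup>2"
      using step[OF Suc.prems] by (simp add: q_def algebra_simps)
    also have "\<dots> \<le> (1 - 2 / q) * (2 * C / q) + 2 * C / q\<^sup>2"
      using Suc q by (intro add_right_mono mult_left_mono) (auto simp: q_def)
    also have "\<dots> = 2 * C * ((q - 1) / q\<^sup>2)"
      using q by (simp add: field_simps power2_eq_square)
    also have "\<dots> \<le> 2 * C * (1 / (q + 1))"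
      using q C by (intro mult_left_mono) (auto simp: field_simps power2_eq_square)
    finally show ?case by (simp add: q_def add_ac)
  qed
  have window: "D * (4 * (real T + 1 - real K) / (real K + real T + 4))
      \<le> 2 * C * (1 / (real K + 2) + 1 / (real K + 1) - 1 / (real T + 2))"
    if K: "1 \<le> K" "K \<le> T" for K
  proof -
    have "D * (4 * (real T + 1 - real K) / (real K + real T + 4))
        = 2 * D * (2 * (real T + 1 - real K) / (real K + real T + 4))" by simp
    also have "\<dots> \<le> 2 * D * (\<Sum>k=K..T. 1 / (real k + 2))"
      using False sum_inverse_lower[OF K(2)] by (intro mult_left_mono) auto
    also have "\<dots> = (\<Sum>k=K..T. 2 / (real k + 2) * D)"
      by (simp add: sum_distrib_left mult.commute)
    also have "\<dots> \<le> (\<Sum>k=K..T. (h k - h (Suc k)) + 2 * C * (1 / (real k + 2)\<^sup>2))"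
    proof (rule sum_mono)
      fix k assume k: "k \<in> {K..T}"
      then have "2 / (real k + 2) * D \<le> 2 / (real k + 2) * \<delta> k"
        using D by (intro mult_left_mono) auto
      then show "2 / (real k + 2) * D \<le> (h k - h (Suc k)) + 2 * C * (1 / (real k + 2)\<^sup>2)"
        using step[of k] k by simp
    qed
    also have "\<dots> = h K - h (Suc T) + 2 * C * (\<Sum>k=K..T. 1 / (real k + 2)\<^sup>2)"
      using sum_Suc_diff[of K T "\<lambda>k. - h k"] K by (simp add: sum.distrib sum_distrib_left)
    also have "\<dots> \<le> 2 * C / (real K + 2) + 2 * C * (1 / (real K + 1) - 1 / (real T + 2))"
    proof -
      have "h K \<le> 2 * C / (real K + 2)" using rate[of "K - 1"] K by (simp add: of_nat_diff add.commute)
      moreover have "2 * C * (\<Sum>k=K..T. 1 / (real k + 2)\<^sup>2)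
          \<le> 2 * C * (1 / (real K + 1) - 1 / (real T + 2))"
        using C sum_inverse_square_upper[OF K(2)] by (intro mult_left_mono) auto
      ultimately show ?thesis using h_end by linarith
    qed
    finally show ?thesis by (simp add: algebra_simps)
  qed
  have conclude: ?thesis
    if "D * a \<le> 2 * C * b" "a > 0" "4 * real T * b \<le> 9 * a" for a b
  proof -
    have "D * a * (4 * real T) \<le> 2 * C * b * (4 * real T)"
      using that(1) by (intro mult_right_mono) auto
    also have "\<dots> = 2 * C * (4 * real T * b)" by simp
    also have "\<dots> \<le> 2 * C * (9 * a)" using C that(3) by (intro mult_left_mono) auto
    finally have "a * (D * (4 * real T)) \<le> a * (18 * C)" by (simp add: algebra_simps)
    then have "D * (4 * real T) \<le> 18 * C" using that(2) by simp
    then show ?thesis using T by (simp add: field_simps)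
  qed
  show ?thesis
  proof (cases "even T")
    case True
    then obtain p where p: "T = 2 * p" by (elim evenE)
    define P where "P = real p"
    have P: "P \<ge> 1" using T p by (simp add: P_def)
    have RT: "real T = 2 * P" by (simp add: p P_def)
    show ?thesis
    proof (rule conclude)
      show "D * (4 * (P + 1) / (3 * P + 4))
          \<le> 2 * C * (1 / (P + 2) + 1 / (P + 1) - 1 / (2 * P + 2))"
        using window[of p] T unfolding RT P_def by (simp add: p)
      show "4 * (P + 1) / (3 * P + 4) > 0" using P by simp
      have "1 / (P + 2) + 1 / (P + 1) - 1 / (2 * P + 2) = (3 * P + 4) / (2 * (P + 1) * (P + 2))"
        using P by (simp add: divide_simps) (simp add: algebra_simps)
      moreover have "4 * (2 * P) * ((3 * P + 4) / (2 * (P + 1) * (P + 2)))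
          \<le> 9 * (4 * (P + 1) / (3 * P + 4))"
      proof -
        have "8 * P * (3 * P + 4) * (3 * P + 4) \<le> 36 * (P + 1) * (2 * (P + 1) * (P + 2))"
        proof -
          have "0 \<le> 96 * P\<^sup>2 + 232 * P + 144" using P by simp
          then show ?thesis by (simp add: algebra_simps power2_eq_square)
        qed
        then show ?thesis using P by (simp add: divide_simps mult_ac)
      qed
      ultimately show "4 * real T * (1 / (P + 2) + 1 / (P + 1) - 1 / (2 * P + 2))
          \<le> 9 * (4 * (P + 1) / (3 * P + 4))"
        unfolding RT by simp
    qed
  next
    case False
    then obtain p where p: "T = 2 * p + 1" by (elim oddE)
    define P where "P = real p"
    have P: "P \<ge> 0" by (simp add: P_def)
    have RT: "real T = 2 * P + 1" by (simp add: p P_def)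
    show ?thesis
    proof (rule conclude)
      show "D * (4 * (P + 1) / (3 * P + 6))
          \<le> 2 * C * (1 / (P + 3) + 1 / (P + 2) - 1 / (2 * P + 3))"
        using window[of "p + 1"] T unfolding RT P_def by (simp add: p add_ac)
      show "4 * (P + 1) / (3 * P + 6) > 0" using P by simp
      have "1 / (P + 3) + 1 / (P + 2) - 1 / (2 * P + 3)
          = (3 * P\<^sup>2 + 11 * P + 9) / ((P + 3) * (P + 2) * (2 * P + 3))"
        using P by (simp add: divide_simps) (simp add: algebra_simps power2_eq_square)
      moreover have "4 * (2 * P + 1) * ((3 * P\<^sup>2 + 11 * P + 9) / ((P + 3) * (P + 2) * (2 * P + 3)))
          \<le> 9 * (4 * (P + 1) / (3 * P + 6))"
      proof -
        have "4 * (2 * P + 1) * (3 * P\<^sup>2 + 11 * P + 9) * (3 * (P + 2))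
           \<le> 36 * (P + 1) * ((P + 3) * (P + 2) * (2 * P + 3))"
        proof -
          have "(2 * P + 1) * (3 * P\<^sup>2 + 11 * P + 9) \<le> 3 * ((P + 1) * (P + 3) * (2 * P + 3))"
          proof -
            have "0 \<le> 8 * P\<^sup>2 + 25 * P + 18" using P by simp
            then show ?thesis by (simp add: algebra_simps power2_eq_square)
          qed
          then have "12 * (P + 2) * ((2 * P + 1) * (3 * P\<^sup>2 + 11 * P + 9))
              \<le> 12 * (P + 2) * (3 * ((P + 1) * (P + 3) * (2 * P + 3)))"
            using P by (intro mult_left_mono) auto
          moreover have "4 * (2 * P + 1) * (3 * P\<^sup>2 + 11 * P + 9) * (3 * (P + 2))
              = 12 * (P + 2) * ((2 * P + 1) * (3 * P\<^sup>2 + 11 * P + 9))"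
            by algebra
          moreover have "36 * (P + 1) * ((P + 3) * (P + 2) * (2 * P + 3))
              = 12 * (P + 2) * (3 * ((P + 1) * (P + 3) * (2 * P + 3)))"
            by algebra
          ultimately show ?thesis by argo
        qed
        moreover have "3 * P + 6 = 3 * (P + 2)" by simp
        ultimately show ?thesis using P by (simp add: divide_simps mult_ac)
      qed
      ultimately show "4 * real T * (1 / (P + 3) + 1 / (P + 2) - 1 / (2 * P + 3))
          \<le> 9 * (4 * (P + 1) / (3 * P + 6))"
        unfolding RT by simp
    qed
  qed
qed

lemma axis_in_std_simplex: "axis j 1 \<in> std_simplex"
  by (simp add: std_simplex_def axis_def)

lemma frank_wolfe_in_simplex:
  assumes "frank_wolfe F i lam"
  shows "lam k \<in> (std_simplex :: (real ^ 'm::finite) set)"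
proof (induction k)
  case 0
  then show ?case using assms by (simp add: frank_wolfe_def std_simplex_def)
next
  case (Suc k)
  have "lam (Suc k) = (real k / (real k + 2)) *\<^sub>R lam k + (2 / (real k + 2)) *\<^sub>R axis (i k) 1"
    using assms by (simp add: frank_wolfe_def)
  moreover have "convex (std_simplex :: (real ^ 'm) set)"
    unfolding convex_def std_simplex_def
    by (auto simp: sum.distrib sum_distrib_left[symmetric])
  ultimately show ?case
    using Suc axis_in_std_simplex[of "i k"]
    by (auto intro!: convexD simp: add_divide_distrib[symmetric])
qed

text \<open>
  A linear function on the simplex is minimized at a vertex, and the smallest gradient component
  selects that vertex.
\<close>

lemma fw_gap_attained:
  assumes x: "x \<in> std_simplex" and j: "is_arg_min (\<lambda>j. grad F x $ j) (\<lambda>_. True) j"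
  shows "fw_gap F x = grad F x \<bullet> (x - axis j 1)"
    and "u \<in> std_simplex \<Longrightarrow> grad F x \<bullet> (x - u) \<le> fw_gap F x"
proof -
  have le: "grad F x \<bullet> (x - u) \<le> grad F x \<bullet> (x - axis j 1)" if u: "u \<in> std_simplex" for u
  proof -
    have "grad F x \<bullet> axis j 1 = (\<Sum>l\<in>UNIV. u $ l * grad F x $ j)"
      using u by (simp add: inner_axis std_simplex_def sum_distrib_right[symmetric])
    also have "\<dots> \<le> (\<Sum>l\<in>UNIV. u $ l * grad F x $ l)"
      using u j by (intro sum_mono mult_left_mono) (auto simp: std_simplex_def is_arg_min_linorder)
    also have "\<dots> = grad F x \<bullet> u" by (simp add: inner_vec_def mult.commute)
    finally show ?thesis by (simp add: inner_diff_right)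
  qed
  show eq: "fw_gap F x = grad F x \<bullet> (x - axis j 1)"
    unfolding fw_gap_def
    by (rule cSup_eq_maximum) (use le axis_in_std_simplex in auto)
  show "u \<in> std_simplex \<Longrightarrow> grad F x \<bullet> (x - u) \<le> fw_gap F x"
    unfolding eq by (rule le)
qed

text \<open>
  In the recursion the objective gap is measured against \<open>F (lam (Suc T))\<close> instead of the minimum:
  only a comparison point in the simplex with \<open>h (Suc T) \<ge> 0\<close> is required.
\<close>

lemma frank_wolfe_gap_bound:
  fixes F :: "real ^ 'm::finite \<Rightarrow> real"
  assumes fw: "frank_wolfe F i lam"
    and conv: "\<And>x u. x \<in> std_simplex \<Longrightarrow> u \<in> std_simplex \<Longrightarrow> F x + grad F x \<bullet> (u - x) \<le> F u"
    and smooth: "\<And>x j t. x \<in> std_simplex \<Longrightarrow> 0 \<le> t \<Longrightarrow> t \<le> 1 \<Longrightarrow>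
        F (x + t *\<^sub>R (axis j 1 - x)) \<le> F x + t * (grad F x \<bullet> (axis j 1 - x)) + C / 2 * t\<^sup>2"
    and C: "0 \<le> C" and T: "T \<ge> 1"
  shows "(MIN k\<in>{0..T}. fw_gap F (lam k)) \<le> 9 * C / (2 * real T)"
proof (rule frank_wolfe_recursion[OF _ _ _ C T])
  note mem = frank_wolfe_in_simplex[OF fw]
  have arg_min: "is_arg_min (\<lambda>j. grad F (lam k) $ j) (\<lambda>_. True) (i k)" for k
    using fw by (simp add: frank_wolfe_def)
  note gap = fw_gap_attained(1)[OF mem arg_min]
  define h where "h = (\<lambda>k. F (lam k) - F (lam (Suc T)))"
  fix k
  define t where "t = 2 / (real k + 2)"
  have "lam (Suc k) = (real k / (real k + 2)) *\<^sub>R lam k + t *\<^sub>R axis (i k) 1"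
    using fw by (simp add: frank_wolfe_def t_def)
  also have "real k / (real k + 2) = 1 - t" by (simp add: t_def field_simps)
  finally have "lam (Suc k) = lam k + t *\<^sub>R (axis (i k) 1 - lam k)"
    by (simp add: algebra_simps)
  moreover have "0 \<le> t" "t \<le> 1" by (auto simp: t_def)
  ultimately have "F (lam (Suc k)) \<le> F (lam k) + t * (grad F (lam k) \<bullet> (axis (i k) 1 - lam k))
      + C / 2 * t\<^sup>2"
    using smooth[OF mem] by simp
  also have "grad F (lam k) \<bullet> (axis (i k) 1 - lam k) = - fw_gap F (lam k)"
    unfolding gap by (simp add: inner_diff_right)
  finally show "h (Suc k) \<le> h k - 2 / (real k + 2) * fw_gap F (lam k) + 2 * C / (real k + 2)\<^sup>2"
    by (simp add: h_def t_def power_divide)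
  have "grad F (lam k) \<bullet> (lam k - lam (Suc T)) \<le> fw_gap F (lam k)"
    by (rule fw_gap_attained(2)[OF mem arg_min mem])
  then show "h k \<le> fw_gap F (lam k)"
    using conv[OF mem mem, of k "Suc T"] by (simp add: h_def inner_diff_right)
  show "0 \<le> h (Suc T)" by (simp add: h_def)
  show "k \<le> T \<Longrightarrow> (MIN k\<in>{0..T}. fw_gap F (lam k)) \<le> fw_gap F (lam k)"
    by (intro Min_le) auto
qed

section \<open>The bound for the dual objective\<close>

lemma norm_G_map_simplex_le:
  assumes u: "u \<in> std_simplex" and M: "\<And>j. norm (nabla f (z j)) \<le> M"
  shows "norm (G_map f z u) \<le> M"
proof -
  have "norm (G_map f z u) \<le> (\<Sum>j\<in>UNIV. norm (u $ j *\<^sub>R nabla f (z j)))"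
    unfolding G_map_def by (rule norm_sum)
  also have "\<dots> \<le> (\<Sum>j\<in>UNIV. u $ j * M)"
    using u M by (intro sum_mono) (auto simp: std_simplex_def mult_left_mono)
  also have "\<dots> = M" using u by (simp add: std_simplex_def sum_distrib_right[symmetric])
  finally show ?thesis .
qed

theorem mainTheorem4:
  fixes d f \<psi> :: "'a::real_normed_vector \<Rightarrow> ereal"
    and L :: real
    and xbar :: 'a
    and z :: "'m::finite \<Rightarrow> 'a"
    and i :: "nat \<Rightarrow> 'm"
    and lam :: "nat \<Rightarrow> real ^ 'm"
    and T :: nat
  assumes fin_dim: "finite_dimensional TYPE('a)"
    and d_closed_convex: "closed_convex d"
    and d_diff: "\<And>x. x \<in> interior (edom d) \<Longrightarrow> rval d differentiable (at x)"
    and f_closed_convex: "closed_convex f"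
    and f_open: "open (edom f)"
    and f_diff: "\<And>x. x \<in> edom f \<Longrightarrow> rval f differentiable (at x)"
    and f_dom: "edom f \<subseteq> edom d"
    and psi_proper: "proper \<psi>"
    and psi_closed_convex: "closed_convex \<psi>"
    and psi_dom: "edom \<psi> \<subseteq> edom f"
    and psi_int: "interior (edom \<psi>) \<noteq> {}"
    and L_pos: "L > 0"
    and xbar: "xbar \<in> interior (edom \<psi>)"
    and z: "\<And>j. z j \<in> edom \<psi>"
    and d_strong: "strongly_convex_one d"
    and fw: "frank_wolfe (xi d f \<psi> L xbar z) i lam"
    and T: "T \<ge> 1"
  shows "(MIN k\<in>{0..T}. fw_gap (xi d f \<psi> L xbar z) (lam k))
           \<le> 18 / (L * real T) * (MAX j. (dual_norm (nabla f (z j)))\<^sup>2)"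
proof -
  let ?F = "xi d f \<psi> L xbar z"
  define M2 where "M2 = (MAX j. (norm (nabla f (z j)))\<^sup>2)"
  define M where "M = sqrt M2"
  have M2: "(norm (nabla f (z j)))\<^sup>2 \<le> M2" for j
    unfolding M2_def by (intro Max_ge) auto
  have M: "norm (nabla f (z j)) \<le> M" for j
    unfolding M_def by (intro real_le_rsqrt M2)
  have "0 \<le> M2" using M2 zero_le_power2 by (rule order_trans[rotated])
  then have M_sq: "M\<^sup>2 = M2" by (simp add: M_def)
  have "edom f \<subseteq> interior (edom d)" using f_dom f_open by (rule interior_maximal)
  then have "edom \<psi> \<subseteq> interior (edom d)" using psi_dom by blast
  then have "\<exists>y. \<forall>s'. Phi d \<psi> L s + blinfun_apply (s' - s) y \<le> Phi d \<psi> L s' \<and>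
      Phi d \<psi> L s' \<le> Phi d \<psi> L s + blinfun_apply (s' - s) y + (norm (s' - s))\<^sup>2 / (2 * L)" for s
    using psi_proper
    by (intro Phi_quadratic_bounds fin_dim d_closed_convex d_strong psi_closed_convex L_pos)
       (simp_all add: proper_def)
  note bounds = xi_quadratic_bounds[OF this L_pos]
  have "(MIN k\<in>{0..T}. fw_gap ?F (lam k)) \<le> 9 * (4 * M2 / L) / (2 * real T)"
  proof (rule frank_wolfe_gap_bound[OF fw bounds(1) _ _ T])
    show "0 \<le> 4 * M2 / L" using \<open>0 \<le> M2\<close> L_pos by simp
    fix x :: "real ^ 'm" and j and t :: real
    assume x: "x \<in> std_simplex" and t: "0 \<le> t" "t \<le> 1"
    have "norm (G_map f z (axis j 1 - x)) \<le> norm (G_map f z (axis j 1)) + norm (G_map f z x)"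
      unfolding G_map_diff by (rule norm_triangle_ineq4)
    also have "\<dots> \<le> 2 * M"
      using norm_G_map_simplex_le[OF x, of f z M]
        norm_G_map_simplex_le[OF axis_in_std_simplex[of j], of f z M] M
      by fastforce
    finally have "(norm (G_map f z (t *\<^sub>R (axis j 1 - x))))\<^sup>2 \<le> (t * (2 * M))\<^sup>2"
      using t unfolding G_map_scaleR by (intro power_mono) (auto intro: mult_left_mono)
    also have "\<dots> = 4 * M2 * t\<^sup>2" by (simp add: power_mult_distrib M_sq)
    finally have "(norm (G_map f z (t *\<^sub>R (axis j 1 - x))))\<^sup>2 / (2 * L) \<le> 4 * M2 * t\<^sup>2 / (2 * L)"
      using L_pos by (intro divide_right_mono) auto
    also have "\<dots> = 4 * M2 / L / 2 * t\<^sup>2" by simp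
    finally show "?F (x + t *\<^sub>R (axis j 1 - x))
        \<le> ?F x + t * (grad ?F x \<bullet> (axis j 1 - x)) + 4 * M2 / L / 2 * t\<^sup>2"
      using bounds(2)[where xbar = xbar and f = f and z = z and x = x
          and u = "x + t *\<^sub>R (axis j 1 - x)"] by simp
  qed
  also have "\<dots> = 18 / (L * real T) * M2" by (simp add: field_simps)
  finally show ?thesis by (simp add: M2_def dual_norm_eq_norm)
qed

end
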